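(* Let $L=\mathfrak{n}_3$ be the three-dimensional Heisenberg Lie algebra over $\mathbb{C}$, with basis $e_1,e_2,e_3$ and brackets $[e_2,e_3]=e_1$, $[e_3,e_2]=-e_1$, all other brackets of basis elements being zero, regarded as a Leibniz algebra. Then $\dim_{\mathbb{C}} HL^2(L;L)=8$. Moreover, the following bilinear maps $\bar\phi_1,\dots,\bar\phi_8:L\otimes L\to L$ (only nonzero values on pairs of basis vectors are listed) are Leibniz $2$-cocycles whose cohomology classes form a basis of $HL^2(L;L)$: \begin{align*} &\bar\phi_1:\ \bar\phi_1(e_2,e_3)=e_3,\ \bar\phi_1(e_3,e_2)=-e_3;\\ &\bar\phi_2:\ \bar\phi_2(e_1,e_2)=e_2,\ \bar\phi_2(e_2,e_1)=-e_2,\ \bar\phi_2(e_1,e_3)=-e_3,\ \bar\phi_2(e_3,e_1)=e_3;\\ &\bar\phi_3:\ \bar\phi_3(e_1,e_2)=e_3,\ \bar\phi_3(e_2,e_1)=-e_3;\\ &\bar\phi_4:\ \bar\phi_4(e_1,e_3)=e_1,\ \bar\phi_4(e_3,e_1)=-e_1;\\ &\bar\phi_5:\ \bar\phi_5(e_1,e_3)=e_2,\ \bar\phi_5(e_3,e_1)=-e_2;\\ &\bar\phi_6:\ \bar\phi_6(e_2,e_2)=e_1;\\ &\bar\phi_7:\ \bar\phi_7(e_3,e_2)=e_1;\\ &\bar\phi_8:\ \bar\phi_8(e_3,e_3)=e_1. \end{align*}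
   Context: A Leibniz algebra over a field $\mathbb{K}$ is a $\mathbb{K}$-vector space $L$ with a bilinear bracket satisfying $[x,[y,z]]=[[x,y],z]-[[x,z],y]$ for all $x,y,z\in L$. Every Lie algebra is a Leibniz algebra. The Leibniz cochain complex of $L$ with coefficients in itself is $CL^n(L;L)=\mathrm{Hom}_{\mathbb{K}}(L^{\otimes n},L)$, $n\ge 0$, with differential $\delta^n:CL^n(L;L)\to CL^{n+1}(L;L)$, $$\delta^n f(x_1,\dots,x_{n+1})=[x_1,f(x_2,\dots,x_{n+1})]+\sum_{i=2}^{n+1}(-1)^i[f(x_1,\dots,\hat x_i,\dots,x_{n+1}),x_i]+\sum_{1\le i<j\le n+1}(-1)^{j+1}f(x_1,\dots,x_{i-1},[x_i,x_j],x_{i+1},\dots,\hat x_j,\dots,x_{n+1}).$$ Its $n$-th cohomology is denoted $HL^n(L;L)$; Leibniz $2$-cocycles are the elements of $\ker\delta^2$. *)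

theory Defs
  imports "HOL-Analysis.Cartesian_Space" "HOL-Algebra.AbelCoset" "Jordan_Normal_Form.VS_Connect"
begin

no_notation vec_index (infixl \<open>$\<close> 100)

section \<open>Leibniz algebras and Lie algebras\<close>

locale bracket_algebra = vector_space scale
  for scale :: "'k::field \<Rightarrow> 'v::ab_group_add \<Rightarrow> 'v" (infixr \<open>*\<^sub>L\<close> 75) +
  fixes bracket :: "'v \<Rightarrow> 'v \<Rightarrow> 'v" (\<open>\<lbrakk>_,/ _\<rbrakk>\<close>)
  assumes bracket_linear_left: "Vector_Spaces.linear scale scale (\<lambda>x. \<lbrakk>x, y\<rbrakk>)"
    and bracket_linear_right: "Vector_Spaces.linear scale scale (\<lambda>y. \<lbrakk>x, y\<rbrakk>)"

locale leibniz_algebra = bracket_algebra scale bracket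
  for scale :: "'k::field \<Rightarrow> 'v::ab_group_add \<Rightarrow> 'v" (infixr \<open>*\<^sub>L\<close> 75)
  and bracket :: "'v \<Rightarrow> 'v \<Rightarrow> 'v" (\<open>\<lbrakk>_,/ _\<rbrakk>\<close>) +
  assumes leibniz: "\<lbrakk>x, \<lbrakk>y, z\<rbrakk>\<rbrakk> = \<lbrakk>\<lbrakk>x, y\<rbrakk>, z\<rbrakk> - \<lbrakk>\<lbrakk>x, z\<rbrakk>, y\<rbrakk>"

locale lie_algebra = bracket_algebra scale bracket
  for scale :: "'k::field \<Rightarrow> 'v::ab_group_add \<Rightarrow> 'v" (infixr \<open>*\<^sub>L\<close> 75)
  and bracket :: "'v \<Rightarrow> 'v \<Rightarrow> 'v" (\<open>\<lbrakk>_,/ _\<rbrakk>\<close>) +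
  assumes alternating: "\<lbrakk>x, x\<rbrakk> = 0"
    and jacobi: "\<lbrakk>x, \<lbrakk>y, z\<rbrakk>\<rbrakk> + \<lbrakk>y, \<lbrakk>z, x\<rbrakk>\<rbrakk> + \<lbrakk>z, \<lbrakk>x, y\<rbrakk>\<rbrakk> = 0"
begin

lemma bracket_add_left: "\<lbrakk>x + x', y\<rbrakk> = \<lbrakk>x, y\<rbrakk> + \<lbrakk>x', y\<rbrakk>"
proof -
  interpret left: Vector_Spaces.linear scale scale "\<lambda>x. \<lbrakk>x, y\<rbrakk>"
    by (rule bracket_linear_left)
  show ?thesis
    by (rule left.add)
qed

lemma bracket_add_right: "\<lbrakk>x, y + y'\<rbrakk> = \<lbrakk>x, y\<rbrakk> + \<lbrakk>x, y'\<rbrakk>"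
proof -
  interpret right: Vector_Spaces.linear scale scale "\<lambda>y. \<lbrakk>x, y\<rbrakk>"
    by (rule bracket_linear_right)
  show ?thesis
    by (rule right.add)
qed

lemma antisymmetric: "\<lbrakk>x, y\<rbrakk> = - \<lbrakk>y, x\<rbrakk>"
proof -
  have "\<lbrakk>x + y, x + y\<rbrakk> = (\<lbrakk>x, x\<rbrakk> + \<lbrakk>y, x\<rbrakk>) + (\<lbrakk>x, y\<rbrakk> + \<lbrakk>y, y\<rbrakk>)"
    by (simp only: bracket_add_left bracket_add_right)
  then have "\<lbrakk>y, x\<rbrakk> + \<lbrakk>x, y\<rbrakk> = 0"
    by (simp only: alternating add_0_left add_0_right)
  then show ?thesis
    by (rule minus_unique[symmetric])
qed

lemma bracket_minus_right: "\<lbrakk>x, - y\<rbrakk> = - \<lbrakk>x, y\<rbrakk>"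
proof -
  interpret right: Vector_Spaces.linear scale scale "\<lambda>y. \<lbrakk>x, y\<rbrakk>"
    by (rule bracket_linear_right)
  show ?thesis
    by (rule right.neg)
qed

end

sublocale lie_algebra \<subseteq> leibniz_algebra
proof
  fix x y z
  have "\<lbrakk>y, \<lbrakk>z, x\<rbrakk>\<rbrakk> = - \<lbrakk>y, \<lbrakk>x, z\<rbrakk>\<rbrakk>"
    by (simp only: antisymmetric[of z x] bracket_minus_right)
  also have "\<dots> = \<lbrakk>\<lbrakk>x, z\<rbrakk>, y\<rbrakk>"
    by (rule antisymmetric[symmetric])
  finally have "\<lbrakk>x, \<lbrakk>y, z\<rbrakk>\<rbrakk> + \<lbrakk>\<lbrakk>x, z\<rbrakk>, y\<rbrakk> + \<lbrakk>z, \<lbrakk>x, y\<rbrakk>\<rbrakk> = 0"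
    using jacobi[of x y z] by (rule subst)
  then have "\<lbrakk>x, \<lbrakk>y, z\<rbrakk>\<rbrakk> + \<lbrakk>\<lbrakk>x, z\<rbrakk>, y\<rbrakk> = - \<lbrakk>z, \<lbrakk>x, y\<rbrakk>\<rbrakk>"
    by (simp only: eq_neg_iff_add_eq_0)
  also have "\<dots> = \<lbrakk>\<lbrakk>x, y\<rbrakk>, z\<rbrakk>"
    by (rule antisymmetric[symmetric])
  finally show "\<lbrakk>x, \<lbrakk>y, z\<rbrakk>\<rbrakk> = \<lbrakk>\<lbrakk>x, y\<rbrakk>, z\<rbrakk> - \<lbrakk>\<lbrakk>x, z\<rbrakk>, y\<rbrakk>"
    by (simp only: eq_diff_eq)
qed

section \<open>Quotient modules\<close>

text \<open>The fields \<open>mult\<close> and \<open>one\<close> of the record type \<open>module\<close> play no role in a module.\<close>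

definition quotient_module ::
  "('k, 'm) module \<Rightarrow> 'm set \<Rightarrow> ('k, 'm set) module" where
  "quotient_module M N =
    \<lparr>carrier = a_rcosets\<^bsub>M\<^esub> N, mult = undefined, one = undefined,
     zero = N, add = set_add M,
     smult = (\<lambda>c X. \<Union>x\<in>X. N +>\<^bsub>M\<^esub> (c \<odot>\<^bsub>M\<^esub> x))\<rparr>"

section \<open>The Leibniz complex with adjoint coefficients\<close>

text \<open>The list \<open>xs\<close> without its \<open>i\<close>-th entry; positions are counted from 1.\<close>

definition omit :: "nat \<Rightarrow> 'v list \<Rightarrow> 'v list" where
  "omit i xs = take (i - 1) xs @ drop i xs"

context leibniz_algebra
begin

text \<open>
  Linear maps on \<open>L\<^sup>\<otimes>\<^sup>n\<close> are represented by multilinear maps in \<open>n\<close> arguments, that is,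
  by functions on lists of length \<open>n\<close>, extended by \<open>0\<close> to lists of any other length.
\<close>

definition cochains :: "nat \<Rightarrow> ('v list \<Rightarrow> 'v) set" where
  "cochains n = {f.
     (\<forall>xs i. length xs = n \<and> i < n \<longrightarrow> Vector_Spaces.linear scale scale (\<lambda>v. f (xs[i := v])))
   \<and> (\<forall>xs. length xs \<noteq> n \<longrightarrow> f xs = 0)}"

definition coboundary_map :: "nat \<Rightarrow> ('v list \<Rightarrow> 'v) \<Rightarrow> 'v list \<Rightarrow> 'v" where
  "coboundary_map n f xs =
    (if length xs = n + 1 then
       let x = (\<lambda>i. xs ! (i - 1)) in
       \<lbrakk>x 1, f (omit 1 xs)\<rbrakk>
       + (\<Sum>i=2..n+1. (-1) ^ i *\<^sub>L \<lbrakk>f (omit i xs), x i\<rbrakk>)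
       + (\<Sum>(i, j) \<in> {(i, j). 1 \<le> i \<and> i < j \<and> j \<le> n + 1}.
            (-1) ^ (j + 1) *\<^sub>L f (omit j (xs[i - 1 := \<lbrakk>x i, x j\<rbrakk>])))
     else 0)"

definition cocycles :: "nat \<Rightarrow> ('v list \<Rightarrow> 'v) set" where
  "cocycles n = {f \<in> cochains n. coboundary_map n f = (\<lambda>_. 0)}"

definition coboundaries :: "nat \<Rightarrow> ('v list \<Rightarrow> 'v) set" where
  "coboundaries n = (case n of 0 \<Rightarrow> {\<lambda>_. 0} | Suc m \<Rightarrow> coboundary_map m ` cochains m)"

definition cocycle_module :: "nat \<Rightarrow> ('k, 'v list \<Rightarrow> 'v) module" where
  "cocycle_module n =
    \<lparr>carrier = cocycles n, mult = undefined, one = undefined,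
     zero = (\<lambda>_. 0), add = (\<lambda>f g xs. f xs + g xs), smult = (\<lambda>c f xs. c *\<^sub>L f xs)\<rparr>"

definition HL :: "nat \<Rightarrow> ('k, ('v list \<Rightarrow> 'v) set) module" where
  "HL n = quotient_module (cocycle_module n) (coboundaries n)"

definition cohomology_class :: "nat \<Rightarrow> ('v list \<Rightarrow> 'v) \<Rightarrow> ('v list \<Rightarrow> 'v) set" where
  "cohomology_class n f = coboundaries n +>\<^bsub>cocycle_module n\<^esub> f"

end

section \<open>The Heisenberg Lie algebra\<close>

text \<open>
  The space is \<open>\<complex>\<^sup>3\<close> with its standard basis. In the index type \<^typ>\<open>3\<close> the numeral
  \<open>3\<close> coincides with \<open>0\<close>, and \<open>1\<close>, \<open>2\<close>, \<open>3\<close> are its three elements.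
\<close>

abbreviation ee :: "3 \<Rightarrow> complex ^ 3" where
  "ee i \<equiv> axis i 1"

text \<open>
  The bilinear map whose values on pairs of basis vectors are listed in a table;
  pairs that are not listed are mapped to \<open>0\<close>.
\<close>

definition bilinear_of ::
  "((3 \<times> 3) \<times> (complex ^ 3)) list \<Rightarrow> complex ^ 3 \<Rightarrow> complex ^ 3 \<Rightarrow> complex ^ 3" where
  "bilinear_of T x y =
    (\<Sum>i\<in>UNIV. \<Sum>j\<in>UNIV.
       (x $ i * y $ j) *s (case map_of T (i, j) of None \<Rightarrow> 0 | Some v \<Rightarrow> v))"

definition heisenberg_bracket :: "complex ^ 3 \<Rightarrow> complex ^ 3 \<Rightarrow> complex ^ 3" where
  "heisenberg_bracket = bilinear_of [((2, 3), ee 1), ((3, 2), - ee 1)]"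

lemma linear_bilinear_of_left: "Vector_Spaces.linear (*s) (*s) (\<lambda>x. bilinear_of T x y)"
proof -
  have "bilinear_of T (x + x') y = bilinear_of T x y + bilinear_of T x' y" for x x'
    unfolding bilinear_of_def
    by (simp only: vector_add_component distrib_right vec.scale_left_distrib sum.distrib)
  moreover have "bilinear_of T (c *s x) y = c *s bilinear_of T x y" for c x
    unfolding bilinear_of_def
    by (simp only: vector_smult_component vec.scale_sum_right vec.scale_scale[symmetric] mult.assoc)
  ultimately show ?thesis
    unfolding Vector_Spaces.linear_iff by (simp add: vec.vector_space_axioms)
qed

lemma linear_bilinear_of_right: "Vector_Spaces.linear (*s) (*s) (\<lambda>y. bilinear_of T x y)"
proof -
  have "bilinear_of T x (y + y') = bilinear_of T x y + bilinear_of T x y'" for y y'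
    unfolding bilinear_of_def
    by (simp only: vector_add_component distrib_left vec.scale_left_distrib sum.distrib)
  moreover have "bilinear_of T x (c *s y) = c *s bilinear_of T x y" for c y
    unfolding bilinear_of_def
    by (simp only: vector_smult_component vec.scale_sum_right vec.scale_scale[symmetric] mult.left_commute)
  ultimately show ?thesis
    unfolding Vector_Spaces.linear_iff by (simp add: vec.vector_space_axioms)
qed

lemma heisenberg_bracket_eq:
  "heisenberg_bracket x y = (x $ 2 * y $ 3 - x $ 3 * y $ 2) *s ee 1"
  by (simp add: heisenberg_bracket_def bilinear_of_def sum_3 vec.scale_left_diff_distrib)

interpretation heisenberg: lie_algebra "(*s)" heisenberg_bracket
proof (intro lie_algebra.intro bracket_algebra.intro bracket_algebra_axioms.intro
    lie_algebra_axioms.intro)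
  show "vector_space ((*s) :: complex \<Rightarrow> complex ^ 3 \<Rightarrow> complex ^ 3)"
    by (rule vec.vector_space_axioms)
  show "Vector_Spaces.linear (*s) (*s) (\<lambda>x. heisenberg_bracket x y)" for y
    unfolding heisenberg_bracket_def by (rule linear_bilinear_of_left)
  show "Vector_Spaces.linear (*s) (*s) (\<lambda>y. heisenberg_bracket x y)" for x
    unfolding heisenberg_bracket_def by (rule linear_bilinear_of_right)
qed (simp_all add: heisenberg_bracket_eq axis_def)

definition cochain_of :: "('v \<Rightarrow> 'v \<Rightarrow> 'v) \<Rightarrow> 'v list \<Rightarrow> 'v::zero" where
  "cochain_of B xs = (case xs of [x, y] \<Rightarrow> B x y | _ \<Rightarrow> 0)"

definition phi_bar :: "(complex ^ 3 \<Rightarrow> complex ^ 3 \<Rightarrow> complex ^ 3) list" where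
  "phi_bar = map bilinear_of
    [[((2, 3), ee 3), ((3, 2), - ee 3)],
     [((1, 2), ee 2), ((2, 1), - ee 2), ((1, 3), - ee 3), ((3, 1), ee 3)],
     [((1, 2), ee 3), ((2, 1), - ee 3)],
     [((1, 3), ee 1), ((3, 1), - ee 1)],
     [((1, 3), ee 2), ((3, 1), - ee 2)],
     [((2, 2), ee 1)],
     [((3, 2), ee 1)],
     [((3, 3), ee 1)]]"

end

theory Submission
  imports Defs
begin

text \<open>
  Cochains in degree 2 are bilinear maps, so the theorem is a question of finite linear algebra.
  It is settled by eight linear functionals on the 2-cocycles, \<open>class_coord\<close>, with three
  properties: they vanish on coboundaries; they are dual to the cocycles \<open>phi_bar\<close>; and a
  cocycle on which all of them vanish is a coboundary. By the first and the last property the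
  functionals are well defined on \<open>HL\<^sup>2\<close> and separate its points, and a family with a
  separating dual family of functionals is a basis (\<open>quotient_basis_if_dual_family\<close>).

  Where the functionals come from: write \<open>f\<^sub>i\<^sub>j\<close> for the value of a cocycle at
  \<open>(e\<^sub>i, e\<^sub>j)\<close>. The cocycle identity on ten triples of basis vectors shows that
  \<open>f\<^sub>1\<^sub>1 = 0\<close>, that \<open>f\<close> is alternating except in its \<open>e\<^sub>1\<close>-component on the span of
  \<open>e\<^sub>2, e\<^sub>3\<close>, and that the \<open>e\<^sub>3\<close>-component of \<open>f\<^sub>1\<^sub>3\<close> is minus the
  \<open>e\<^sub>2\<close>-component of \<open>f\<^sub>1\<^sub>2\<close> (\<open>cocycle_values\<close>). This leaves 11 free parameters. The
  coboundaries form a 3-dimensional space, spanned by the coboundaries of \<open>e\<^sub>1 \<mapsto> e\<^sub>2\<close>,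
  \<open>e\<^sub>1 \<mapsto> e\<^sub>3\<close> and \<open>e\<^sub>2 \<mapsto> e\<^sub>2\<close>; the functionals are the eight combinations of the
  parameters that annihilate these three.
\<close>

section \<open>Quotients of modules\<close>

lemma submodule_abelian_subgroup:
  assumes "submodule R N M"
  shows "abelian_subgroup N M"
proof -
  interpret N: submodule R N M by (rule assms)
  interpret M: Module.module R M by (rule N.module)
  show ?thesis
  proof (rule abelian_subgroupI3)
    show "additive_subgroup N M"
    proof (rule additive_subgroupI, rule M.add.subgroupI)
      show "N \<subseteq> carrier M" by (rule N.subset)
      show "N \<noteq> {}" using N.zero_closed by blast
      show "\<ominus>\<^bsub>M\<^esub> v \<in> N" if "v \<in> N" for v
      proof -
        have "v \<in> carrier M" using that N.subset by blast
        then have "\<ominus>\<^bsub>M\<^esub> v = (\<ominus>\<^bsub>R\<^esub> \<one>\<^bsub>R\<^esub>) \<odot>\<^bsub>M\<^esub> v"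
          by (rule M.smult_minus_1[symmetric])
        also have "\<dots> \<in> N"
          by (rule N.smult_closed) (simp_all add: that)
        finally show ?thesis .
      qed
    qed simp
    show "abelian_group M" by (rule M.abelian_group_axioms)
  qed
qed

text \<open>
  Operations on cosets are operations on representatives. For the scalar action this needs an
  argument: the union in the definition of the quotient runs over all representatives, and each
  of them contributes the same coset because the submodule is closed under scalars.
\<close>

lemma quotient_module_simps:
  assumes "submodule R N M"
  shows "carrier (quotient_module M N) = (\<lambda>x. N +>\<^bsub>M\<^esub> x) ` carrier M"
    and "\<zero>\<^bsub>quotient_module M N\<^esub> = N +>\<^bsub>M\<^esub> \<zero>\<^bsub>M\<^esub>"
    and "x \<in> carrier M \<Longrightarrow> y \<in> carrier M \<Longrightarrow>
      (N +>\<^bsub>M\<^esub> x) \<oplus>\<^bsub>quotient_module M N\<^esub> (N +>\<^bsub>M\<^esub> y) = N +>\<^bsub>M\<^esub> (x \<oplus>\<^bsub>M\<^esub> y)"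
    and "c \<in> carrier R \<Longrightarrow> x \<in> carrier M \<Longrightarrow>
      c \<odot>\<^bsub>quotient_module M N\<^esub> (N +>\<^bsub>M\<^esub> x) = N +>\<^bsub>M\<^esub> (c \<odot>\<^bsub>M\<^esub> x)"
proof -
  interpret N: submodule R N M by (rule assms)
  interpret M: Module.module R M by (rule N.module)
  interpret A: abelian_subgroup N M by (rule submodule_abelian_subgroup[OF assms])
  show "carrier (quotient_module M N) = (\<lambda>x. N +>\<^bsub>M\<^esub> x) ` carrier M"
    by (auto simp: quotient_module_def A_RCOSETS_def')
  show "\<zero>\<^bsub>quotient_module M N\<^esub> = N +>\<^bsub>M\<^esub> \<zero>\<^bsub>M\<^esub>"
    by (simp add: quotient_module_def M.a_coset_add_zero N.subset)
  show "(N +>\<^bsub>M\<^esub> x) \<oplus>\<^bsub>quotient_module M N\<^esub> (N +>\<^bsub>M\<^esub> y) = N +>\<^bsub>M\<^esub> (x \<oplus>\<^bsub>M\<^esub> y)"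
    if "x \<in> carrier M" "y \<in> carrier M"
    using A.a_rcos_sum[OF that] by (simp add: quotient_module_def)
  show "c \<odot>\<^bsub>quotient_module M N\<^esub> (N +>\<^bsub>M\<^esub> x) = N +>\<^bsub>M\<^esub> (c \<odot>\<^bsub>M\<^esub> x)"
    if c: "c \<in> carrier R" and x: "x \<in> carrier M"
  proof -
    have "N +>\<^bsub>M\<^esub> (c \<odot>\<^bsub>M\<^esub> y) = N +>\<^bsub>M\<^esub> (c \<odot>\<^bsub>M\<^esub> x)" if "y \<in> N +>\<^bsub>M\<^esub> x" for y
    proof -
      obtain n where n: "n \<in> N" and y: "y = n \<oplus>\<^bsub>M\<^esub> x"
        using \<open>y \<in> N +>\<^bsub>M\<^esub> x\<close> by (auto simp: a_r_coset_def')
      have "c \<odot>\<^bsub>M\<^esub> y = c \<odot>\<^bsub>M\<^esub> n \<oplus>\<^bsub>M\<^esub> c \<odot>\<^bsub>M\<^esub> x"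
        using c x n N.subset by (auto simp: y M.smult_r_distr)
      then have "c \<odot>\<^bsub>M\<^esub> y \<in> N +>\<^bsub>M\<^esub> (c \<odot>\<^bsub>M\<^esub> x)"
        using c n by (auto simp: a_r_coset_def')
      then show ?thesis
        using A.a_repr_independence'[of "c \<odot>\<^bsub>M\<^esub> y" "c \<odot>\<^bsub>M\<^esub> x"] c x by simp
    qed
    moreover have "x \<in> N +>\<^bsub>M\<^esub> x"
      by (rule A.a_rcos_self[OF x])
    ultimately have "(\<Union>y\<in>N +>\<^bsub>M\<^esub> x. N +>\<^bsub>M\<^esub> (c \<odot>\<^bsub>M\<^esub> y)) = N +>\<^bsub>M\<^esub> (c \<odot>\<^bsub>M\<^esub> x)"
      by blast
    then show ?thesis
      by (simp add: quotient_module_def)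
  qed
qed

lemma quotient_module_is_module:
  assumes "submodule R N M"
  shows "Module.module R (quotient_module M N)"
proof -
  interpret N: submodule R N M by (rule assms)
  interpret M: Module.module R M by (rule N.module)
  let ?Q = "quotient_module M N" and ?p = "\<lambda>x. N +>\<^bsub>M\<^esub> x"
  note Q = quotient_module_simps[OF assms]
  have p: "?p x \<in> carrier ?Q" if "x \<in> carrier M" for x
    using that by (simp add: Q(1))
  have Q_cases: thesis if "v \<in> carrier ?Q" "\<And>x. x \<in> carrier M \<Longrightarrow> v = ?p x \<Longrightarrow> thesis"
    for v thesis
    using that by (auto simp: Q(1))
  have "abelian_group ?Q"
  proof (rule abelian_groupI)
    show "u \<oplus>\<^bsub>?Q\<^esub> v \<in> carrier ?Q" if "u \<in> carrier ?Q" "v \<in> carrier ?Q" for u v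
      using that by (elim Q_cases) (simp add: Q(3) p)
    show "\<zero>\<^bsub>?Q\<^esub> \<in> carrier ?Q"
      unfolding Q(2) by (rule p) simp
    show "u \<oplus>\<^bsub>?Q\<^esub> v \<oplus>\<^bsub>?Q\<^esub> w = u \<oplus>\<^bsub>?Q\<^esub> (v \<oplus>\<^bsub>?Q\<^esub> w)"
      if "u \<in> carrier ?Q" "v \<in> carrier ?Q" "w \<in> carrier ?Q" for u v w
      using that by (elim Q_cases) (simp add: Q(3) M.M.a_assoc)
    show "u \<oplus>\<^bsub>?Q\<^esub> v = v \<oplus>\<^bsub>?Q\<^esub> u" if "u \<in> carrier ?Q" "v \<in> carrier ?Q" for u v
      using that by (elim Q_cases) (simp add: Q(3) M.M.a_comm)
    show "\<zero>\<^bsub>?Q\<^esub> \<oplus>\<^bsub>?Q\<^esub> v = v" if "v \<in> carrier ?Q" for v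
      using that unfolding Q(2)
      by (elim Q_cases) (simp add: Q(3) del: M.a_coset_add_zero)
    show "\<exists>u\<in>carrier ?Q. u \<oplus>\<^bsub>?Q\<^esub> v = \<zero>\<^bsub>?Q\<^esub>" if v: "v \<in> carrier ?Q" for v
    proof -
      from v obtain x where "x \<in> carrier M" "v = ?p x" by (rule Q_cases)
      then have "?p (\<ominus>\<^bsub>M\<^esub> x) \<oplus>\<^bsub>?Q\<^esub> v = \<zero>\<^bsub>?Q\<^esub>" and "?p (\<ominus>\<^bsub>M\<^esub> x) \<in> carrier ?Q"
        by (simp_all add: Q(2,3) M.M.l_neg p del: M.a_coset_add_zero)
      then show ?thesis by blast
    qed
  qed
  then show ?thesis
  proof (rule moduleI[OF M.R.cring_axioms])
    show "c \<odot>\<^bsub>?Q\<^esub> v \<in> carrier ?Q" if "c \<in> carrier R" "v \<in> carrier ?Q" for c v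
      using that(2,1) by (elim Q_cases) (simp add: Q(4) p)
    show "(a \<oplus>\<^bsub>R\<^esub> b) \<odot>\<^bsub>?Q\<^esub> v = a \<odot>\<^bsub>?Q\<^esub> v \<oplus>\<^bsub>?Q\<^esub> b \<odot>\<^bsub>?Q\<^esub> v"
      if "a \<in> carrier R" "b \<in> carrier R" "v \<in> carrier ?Q" for a b v
      using that(3,1,2) by (elim Q_cases) (simp add: Q(3,4) M.smult_l_distr)
    show "a \<odot>\<^bsub>?Q\<^esub> (u \<oplus>\<^bsub>?Q\<^esub> v) = a \<odot>\<^bsub>?Q\<^esub> u \<oplus>\<^bsub>?Q\<^esub> a \<odot>\<^bsub>?Q\<^esub> v"
      if "a \<in> carrier R" "u \<in> carrier ?Q" "v \<in> carrier ?Q" for a u v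
      using that(2,3,1) by (elim Q_cases) (simp add: Q(3,4) M.smult_r_distr)
    show "(a \<otimes>\<^bsub>R\<^esub> b) \<odot>\<^bsub>?Q\<^esub> v = a \<odot>\<^bsub>?Q\<^esub> (b \<odot>\<^bsub>?Q\<^esub> v)"
      if "a \<in> carrier R" "b \<in> carrier R" "v \<in> carrier ?Q" for a b v
      using that(3,1,2) by (elim Q_cases) (simp add: Q(4) M.smult_assoc1)
    show "\<one>\<^bsub>R\<^esub> \<odot>\<^bsub>?Q\<^esub> v = v" if "v \<in> carrier ?Q" for v
      using that by (elim Q_cases) (simp add: Q(4))
  qed
qed


section \<open>Bases from dual families of functionals\<close>

lemma (in vectorspace) functional_finsum:
  assumes d_closed: "\<And>v. v \<in> carrier V \<Longrightarrow> d v \<in> carrier K"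
    and d_add: "\<And>v w. v \<in> carrier V \<Longrightarrow> w \<in> carrier V \<Longrightarrow> d (v \<oplus>\<^bsub>V\<^esub> w) = d v \<oplus>\<^bsub>K\<^esub> d w"
    and d_smult: "\<And>c v. c \<in> carrier K \<Longrightarrow> v \<in> carrier V \<Longrightarrow> d (c \<odot>\<^bsub>V\<^esub> v) = c \<otimes>\<^bsub>K\<^esub> d v"
    and "finite I" "w \<in> I \<rightarrow> carrier V" "a \<in> I \<rightarrow> carrier K"
  shows "d (\<Oplus>\<^bsub>V\<^esub>i\<in>I. a i \<odot>\<^bsub>V\<^esub> w i) = (\<Oplus>\<^bsub>K\<^esub>i\<in>I. a i \<otimes>\<^bsub>K\<^esub> d (w i))"
  using assms(4,5,6)
proof (induction I rule: finite_induct)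
  case empty
  have "d (\<zero>\<^bsub>K\<^esub> \<odot>\<^bsub>V\<^esub> \<zero>\<^bsub>V\<^esub>) = \<zero>\<^bsub>K\<^esub> \<otimes>\<^bsub>K\<^esub> d \<zero>\<^bsub>V\<^esub>"
    by (rule d_smult) auto
  then show ?case
    using d_closed[of "\<zero>\<^bsub>V\<^esub>"] by simp
next
  case (insert i I)
  have I: "(\<lambda>i. a i \<odot>\<^bsub>V\<^esub> w i) \<in> I \<rightarrow> carrier V" "(\<lambda>i. a i \<otimes>\<^bsub>K\<^esub> d (w i)) \<in> I \<rightarrow> carrier K"
    using insert.prems d_closed by (auto simp: Pi_iff)
  have i: "w i \<in> carrier V" "a i \<in> carrier K" "d (w i) \<in> carrier K"
    using insert.prems d_closed by auto
  have "d (\<Oplus>\<^bsub>V\<^esub>i\<in>insert i I. a i \<odot>\<^bsub>V\<^esub> w i) = d (a i \<odot>\<^bsub>V\<^esub> w i \<oplus>\<^bsub>V\<^esub> (\<Oplus>\<^bsub>V\<^esub>i\<in>I. a i \<odot>\<^bsub>V\<^esub> w i))"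
    using insert.hyps I i by (simp add: M.finsum_insert)
  also have "\<dots> = a i \<otimes>\<^bsub>K\<^esub> d (w i) \<oplus>\<^bsub>K\<^esub> d (\<Oplus>\<^bsub>V\<^esub>i\<in>I. a i \<odot>\<^bsub>V\<^esub> w i)"
    using I i by (simp add: d_add d_smult)
  also have "\<dots> = (\<Oplus>\<^bsub>K\<^esub>i\<in>insert i I. a i \<otimes>\<^bsub>K\<^esub> d (w i))"
    using insert I i by (simp add: R.finsum_insert)
  finally show ?case .
qed

text \<open>
  Applying \<open>d i\<close> to a linear combination of the \<open>w j\<close> returns its \<open>i\<close>-th coefficient, which
  gives independence. For generation, the difference of \<open>v\<close> and the sum of the
  \<open>d i v \<odot> w i\<close> is annihilated by every functional, hence zero.
\<close>

lemma (in vectorspace) basis_if_dual_family: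
  assumes fin: "finite I" and w: "w \<in> I \<rightarrow> carrier V"
    and d_closed: "\<And>i v. i \<in> I \<Longrightarrow> v \<in> carrier V \<Longrightarrow> d i v \<in> carrier K"
    and d_add: "\<And>i u v. i \<in> I \<Longrightarrow> u \<in> carrier V \<Longrightarrow> v \<in> carrier V \<Longrightarrow>
      d i (u \<oplus>\<^bsub>V\<^esub> v) = d i u \<oplus>\<^bsub>K\<^esub> d i v"
    and d_smult: "\<And>i c v. i \<in> I \<Longrightarrow> c \<in> carrier K \<Longrightarrow> v \<in> carrier V \<Longrightarrow>
      d i (c \<odot>\<^bsub>V\<^esub> v) = c \<otimes>\<^bsub>K\<^esub> d i v"
    and dual: "\<And>i j. i \<in> I \<Longrightarrow> j \<in> I \<Longrightarrow> d i (w j) = (if i = j then \<one>\<^bsub>K\<^esub> else \<zero>\<^bsub>K\<^esub>)"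
    and separating: "\<And>v. v \<in> carrier V \<Longrightarrow> (\<And>i. i \<in> I \<Longrightarrow> d i v = \<zero>\<^bsub>K\<^esub>) \<Longrightarrow> v = \<zero>\<^bsub>V\<^esub>"
  shows "inj_on w I" and "basis (w ` I)"
proof -
  show inj: "inj_on w I"
  proof (rule inj_onI, rule ccontr)
    fix i j assume "i \<in> I" "j \<in> I" "w i = w j" "i \<noteq> j"
    then have "\<one>\<^bsub>K\<^esub> = \<zero>\<^bsub>K\<^esub>"
      using dual[of i i] dual[of i j] by simp
    then show False by simp
  qed
  have lincomb: "lincomb a (w ` I) = (\<Oplus>\<^bsub>V\<^esub>i\<in>I. a (w i) \<odot>\<^bsub>V\<^esub> w i)" if "a \<in> w ` I \<rightarrow> carrier K" for a
    unfolding lincomb_def using that w inj by (intro M.add.finprod_reindex) auto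
  have coefficient: "d i (\<Oplus>\<^bsub>V\<^esub>j\<in>I. a j \<odot>\<^bsub>V\<^esub> w j) = a i" if a: "a \<in> I \<rightarrow> carrier K" and i: "i \<in> I" for a i
  proof -
    have "d i (\<Oplus>\<^bsub>V\<^esub>j\<in>I. a j \<odot>\<^bsub>V\<^esub> w j) = (\<Oplus>\<^bsub>K\<^esub>j\<in>I. a j \<otimes>\<^bsub>K\<^esub> d i (w j))"
      using i by (intro functional_finsum fin w a d_closed d_add d_smult)
    also have "\<dots> = (\<Oplus>\<^bsub>K\<^esub>j\<in>I. if i = j then a j else \<zero>\<^bsub>K\<^esub>)"
      using a i by (intro R.finsum_cong') (auto simp: dual Pi_iff)
    also have "\<dots> = a i"
      using fin a i by (intro R.add.finprod_singleton) auto
    finally show ?thesis .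
  qed
  show "basis (w ` I)"
    unfolding basis_def
  proof (intro conjI)
    show sub: "w ` I \<subseteq> carrier V" using w by auto
    show "\<not> lin_dep (w ` I)"
    proof (rule finite_lin_indpt2[OF _ sub])
      fix a assume a: "a \<in> w ` I \<rightarrow> carrier K" and 0: "lincomb a (w ` I) = \<zero>\<^bsub>V\<^esub>"
      have "d i \<zero>\<^bsub>V\<^esub> = \<zero>\<^bsub>K\<^esub>" if "i \<in> I" for i
        using coefficient[of "\<lambda>_. \<zero>\<^bsub>K\<^esub>" i] w that by (simp add: Pi_iff M.finsum_all0)
      then show "\<forall>v\<in>w ` I. a v = \<zero>\<^bsub>K\<^esub>"
        using coefficient[of "\<lambda>i. a (w i)"] a 0 by (auto simp: lincomb Pi_iff)
    qed (use fin in simp)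
    show "span (w ` I) = carrier V"
    proof (intro equalityI subsetI)
      fix v assume "v \<in> span (w ` I)"
      then show "v \<in> carrier V" using span_is_subset2[OF sub] by blast
    next
      fix v assume v: "v \<in> carrier V"
      define s where "s = (\<Oplus>\<^bsub>V\<^esub>i\<in>I. d i v \<odot>\<^bsub>V\<^esub> w i)"
      have s: "s \<in> carrier V"
        unfolding s_def using w v d_closed by (intro M.finsum_closed) (auto simp: Pi_iff)
      have "v \<ominus>\<^bsub>V\<^esub> s = \<zero>\<^bsub>V\<^esub>"
      proof (rule separating)
        show "v \<ominus>\<^bsub>V\<^esub> s \<in> carrier V" using v s by simp
        fix i assume i: "i \<in> I"
        have "d i v = d i ((v \<ominus>\<^bsub>V\<^esub> s) \<oplus>\<^bsub>V\<^esub> s)"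
          using v s by (simp add: M.minus_eq M.a_assoc M.l_neg)
        also have "\<dots> = d i (v \<ominus>\<^bsub>V\<^esub> s) \<oplus>\<^bsub>K\<^esub> d i v"
          using v s i coefficient[of "\<lambda>i. d i v" i] by (simp add: d_add d_closed Pi_iff s_def)
        finally show "d i (v \<ominus>\<^bsub>V\<^esub> s) = \<zero>\<^bsub>K\<^esub>"
          using v s i by (simp only: R.add.r_cancel_one' d_closed M.minus_closed)
      qed
      then have "v = s"
        using v s by simp
      also have "s = lincomb (\<lambda>v'. d (the_inv_into I w v') v) (w ` I)"
        using v w inj d_closed unfolding s_def
        by (subst lincomb) (auto simp: the_inv_into_f_f Pi_iff intro!: M.finsum_cong')
      also have "\<dots> \<in> span (w ` I)"
        unfolding finite_span[OF finite_imageI[OF fin] sub]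
        using v inj d_closed
        by (intro CollectI exI conjI refl funcsetI) (auto simp: the_inv_into_f_f)
      finally show "v \<in> span (w ` I)" .
    qed
  qed
qed

text \<open>
  This form lets one work with representatives throughout: if the common kernel of the
  functionals is exactly \<open>N\<close>, they descend to a separating family on the quotient.
\<close>

lemma quotient_basis_if_dual_family:
  assumes V: "vectorspace K V" and N: "submodule K N V"
    and fin: "finite I" and w: "w \<in> I \<rightarrow> carrier V"
    and d_closed: "\<And>i v. i \<in> I \<Longrightarrow> v \<in> carrier V \<Longrightarrow> d i v \<in> carrier K"
    and d_add: "\<And>i u v. i \<in> I \<Longrightarrow> u \<in> carrier V \<Longrightarrow> v \<in> carrier V \<Longrightarrow>
      d i (u \<oplus>\<^bsub>V\<^esub> v) = d i u \<oplus>\<^bsub>K\<^esub> d i v"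
    and d_smult: "\<And>i c v. i \<in> I \<Longrightarrow> c \<in> carrier K \<Longrightarrow> v \<in> carrier V \<Longrightarrow>
      d i (c \<odot>\<^bsub>V\<^esub> v) = c \<otimes>\<^bsub>K\<^esub> d i v"
    and dual: "\<And>i j. i \<in> I \<Longrightarrow> j \<in> I \<Longrightarrow> d i (w j) = (if i = j then \<one>\<^bsub>K\<^esub> else \<zero>\<^bsub>K\<^esub>)"
    and kernel: "\<And>v. v \<in> carrier V \<Longrightarrow> v \<in> N \<longleftrightarrow> (\<forall>i\<in>I. d i v = \<zero>\<^bsub>K\<^esub>)"
  shows "vectorspace K (quotient_module V N)"
    and "inj_on (\<lambda>i. N +>\<^bsub>V\<^esub> w i) I"
    and "vectorspace.basis K (quotient_module V N) ((\<lambda>i. N +>\<^bsub>V\<^esub> w i) ` I)"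
proof -
  interpret V: vectorspace K V by (rule V)
  interpret N: submodule K N V by (rule N)
  interpret A: abelian_subgroup N V by (rule submodule_abelian_subgroup[OF N])
  show Q: "vectorspace K (quotient_module V N)"
    by (rule vectorspace.intro[OF quotient_module_is_module[OF N] V.field.field_axioms])
  interpret Q: vectorspace K "quotient_module V N" by (rule Q)
  note simps = quotient_module_simps[OF N]
  \<comment> \<open>\<open>d i\<close> vanishes on \<open>N\<close>, so its image of a coset is a singleton.\<close>
  define q where "q = (\<lambda>i X. the_elem (d i ` X))"
  have q: "q i (N +>\<^bsub>V\<^esub> v) = d i v" if i: "i \<in> I" and v: "v \<in> carrier V" for i v
  proof -
    have "d i u = d i v" if "u \<in> N +>\<^bsub>V\<^esub> v" for u
    proof -
      obtain n where "n \<in> N" "u = n \<oplus>\<^bsub>V\<^esub> v"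
        using \<open>u \<in> N +>\<^bsub>V\<^esub> v\<close> by (auto simp: a_r_coset_def')
      moreover from this have "n \<in> carrier V" "d i n = \<zero>\<^bsub>K\<^esub>"
        using N.subset kernel i by blast+
      ultimately show ?thesis
        using i v by (simp add: d_add d_closed)
    qed
    then have "d i ` (N +>\<^bsub>V\<^esub> v) = {d i v}"
      using A.a_rcos_self[OF v] by blast
    then show ?thesis
      by (simp add: q_def)
  qed
  have Q_cases: thesis
    if "X \<in> carrier (quotient_module V N)" "\<And>v. v \<in> carrier V \<Longrightarrow> X = N +>\<^bsub>V\<^esub> v \<Longrightarrow> thesis" for X thesis
    using that by (auto simp: simps(1))
  have 1: "(\<lambda>i. N +>\<^bsub>V\<^esub> w i) \<in> I \<rightarrow> carrier (quotient_module V N)"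
    using w by (auto simp: simps(1))
  have 2: "q i X \<in> carrier K" if "i \<in> I" "X \<in> carrier (quotient_module V N)" for i X
    using that(2,1) by (elim Q_cases) (simp add: q d_closed)
  have 3: "q i (X \<oplus>\<^bsub>quotient_module V N\<^esub> Y) = q i X \<oplus>\<^bsub>K\<^esub> q i Y"
    if "i \<in> I" "X \<in> carrier (quotient_module V N)" "Y \<in> carrier (quotient_module V N)" for i X Y
    using that(2,3,1) by (elim Q_cases) (simp add: q d_add simps(3))
  have 4: "q i (c \<odot>\<^bsub>quotient_module V N\<^esub> X) = c \<otimes>\<^bsub>K\<^esub> q i X"
    if "i \<in> I" "c \<in> carrier K" "X \<in> carrier (quotient_module V N)" for i c X
    using that(3,1,2) by (elim Q_cases) (simp add: q d_smult simps(4))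
  have 5: "q i (N +>\<^bsub>V\<^esub> w j) = (if i = j then \<one>\<^bsub>K\<^esub> else \<zero>\<^bsub>K\<^esub>)" if "i \<in> I" "j \<in> I" for i j
    using that w dual[OF that] q[of i "w j"] by (auto simp: Pi_iff)
  have 6: "X = \<zero>\<^bsub>quotient_module V N\<^esub>"
    if in_Q: "X \<in> carrier (quotient_module V N)" and 0: "\<And>i. i \<in> I \<Longrightarrow> q i X = \<zero>\<^bsub>K\<^esub>" for X
  proof -
    obtain v where v: "v \<in> carrier V" and X: "X = N +>\<^bsub>V\<^esub> v"
      using in_Q by (rule Q_cases)
    have "v \<in> N"
      using 0 v by (simp add: kernel X q)
    then show ?thesis
      by (simp add: X A.a_rcos_const quotient_module_def)
  qed
  show "inj_on (\<lambda>i. N +>\<^bsub>V\<^esub> w i) I"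
    by (rule Q.basis_if_dual_family(1)[OF fin 1 2 3 4 5 6])
  show "Q.basis ((\<lambda>i. N +>\<^bsub>V\<^esub> w i) ` I)"
    by (rule Q.basis_if_dual_family(2)[OF fin 1 2 3 4 5 6])
qed

section \<open>The Leibniz complex in low degrees\<close>

context leibniz_algebra
begin

lemma bracket_simps:
  "\<lbrakk>x + x', y\<rbrakk> = \<lbrakk>x, y\<rbrakk> + \<lbrakk>x', y\<rbrakk>" "\<lbrakk>x, y + y'\<rbrakk> = \<lbrakk>x, y\<rbrakk> + \<lbrakk>x, y'\<rbrakk>"
  "\<lbrakk>c *\<^sub>L x, y\<rbrakk> = c *\<^sub>L \<lbrakk>x, y\<rbrakk>" "\<lbrakk>x, c *\<^sub>L y\<rbrakk> = c *\<^sub>L \<lbrakk>x, y\<rbrakk>"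
  "\<lbrakk>0, y\<rbrakk> = 0" "\<lbrakk>x, 0\<rbrakk> = 0"
  "\<lbrakk>- x, y\<rbrakk> = - \<lbrakk>x, y\<rbrakk>" "\<lbrakk>x, - y\<rbrakk> = - \<lbrakk>x, y\<rbrakk>"
  "\<lbrakk>x - x', y\<rbrakk> = \<lbrakk>x, y\<rbrakk> - \<lbrakk>x', y\<rbrakk>" "\<lbrakk>x, y - y'\<rbrakk> = \<lbrakk>x, y\<rbrakk> - \<lbrakk>x, y'\<rbrakk>"
proof -
  interpret l: Vector_Spaces.linear scale scale "\<lambda>x. \<lbrakk>x, y\<rbrakk>" for y by (rule bracket_linear_left)
  interpret r: Vector_Spaces.linear scale scale "\<lambda>y. \<lbrakk>x, y\<rbrakk>" for x by (rule bracket_linear_right)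
  show "\<lbrakk>x + x', y\<rbrakk> = \<lbrakk>x, y\<rbrakk> + \<lbrakk>x', y\<rbrakk>" "\<lbrakk>x, y + y'\<rbrakk> = \<lbrakk>x, y\<rbrakk> + \<lbrakk>x, y'\<rbrakk>"
    "\<lbrakk>c *\<^sub>L x, y\<rbrakk> = c *\<^sub>L \<lbrakk>x, y\<rbrakk>" "\<lbrakk>x, c *\<^sub>L y\<rbrakk> = c *\<^sub>L \<lbrakk>x, y\<rbrakk>"
    "\<lbrakk>0, y\<rbrakk> = 0" "\<lbrakk>x, 0\<rbrakk> = 0" "\<lbrakk>- x, y\<rbrakk> = - \<lbrakk>x, y\<rbrakk>" "\<lbrakk>x, - y\<rbrakk> = - \<lbrakk>x, y\<rbrakk>"
    "\<lbrakk>x - x', y\<rbrakk> = \<lbrakk>x, y\<rbrakk> - \<lbrakk>x', y\<rbrakk>" "\<lbrakk>x, y - y'\<rbrakk> = \<lbrakk>x, y\<rbrakk> - \<lbrakk>x, y'\<rbrakk>"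
    by (fact l.add r.add l.scale r.scale l.zero r.zero l.neg r.neg l.diff r.diff)+
qed

lemma zero_cochain: "(\<lambda>_. 0) \<in> cochains n"
  by (simp add: cochains_def Vector_Spaces.linear_iff vector_space_axioms)

lemma add_cochain: "f \<in> cochains n \<Longrightarrow> g \<in> cochains n \<Longrightarrow> (\<lambda>xs. f xs + g xs) \<in> cochains n"
  by (simp add: cochains_def Vector_Spaces.linear_iff algebra_simps scale_right_distrib)

lemma scale_cochain: "f \<in> cochains n \<Longrightarrow> (\<lambda>xs. c *\<^sub>L f xs) \<in> cochains n"
  by (simp add: cochains_def Vector_Spaces.linear_iff scale_right_distrib scale_left_commute)

lemma coboundary_map_add:
  "coboundary_map n (\<lambda>xs. f xs + g xs) = (\<lambda>xs. coboundary_map n f xs + coboundary_map n g xs)"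
  by (rule ext)
    (simp add: coboundary_map_def Let_def bracket_simps scale_right_distrib sum.distrib sum_subtractf sum_negf
      case_prod_unfold)

lemma coboundary_map_scale:
  "coboundary_map n (\<lambda>xs. c *\<^sub>L f xs) = (\<lambda>xs. c *\<^sub>L coboundary_map n f xs)"
  by (rule ext)
    (simp add: coboundary_map_def Let_def bracket_simps scale_right_distrib scale_right_diff_distrib scale_sum_right
      scale_left_commute sum_negf mult.commute case_prod_unfold)

lemma vectorspace_cocycle_module: "vectorspace class_ring (cocycle_module n)"
proof (rule vectorspace.intro[OF _ class_field])
  have scale: "(\<lambda>xs. c *\<^sub>L f xs) \<in> cocycles n" if "f \<in> cocycles n" for c f
    using that by (simp add: cocycles_def scale_cochain coboundary_map_scale)
  have neg: "\<exists>g\<in>cocycles n. (\<lambda>xs. f xs + g xs) = (\<lambda>_. 0)" if "f \<in> cocycles n" for f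
    using scale[OF that, of "- 1"] by (intro bexI[of _ "\<lambda>xs. (- 1) *\<^sub>L f xs"]) simp_all
  have zero: "(\<lambda>_. 0) \<in> cocycles n"
    using coboundary_map_scale[of n 0 "\<lambda>_. 0"] by (simp add: cocycles_def zero_cochain)
  have add: "(\<lambda>xs. f xs + g xs) \<in> cocycles n" if "f \<in> cocycles n" "g \<in> cocycles n" for f g
    using that by (simp add: cocycles_def add_cochain coboundary_map_add)
  show "Module.module class_ring (cocycle_module n)"
    by (rule module_criteria)
      (simp_all add: cocycle_module_def class_cring.cring_axioms zero neg scale add
        algebra_simps scale_left_distrib scale_right_distrib)
qed

lemma coboundary_map_1:
  "coboundary_map 1 f [x, y] = \<lbrakk>x, f [y]\<rbrakk> + \<lbrakk>f [x], y\<rbrakk> - f [\<lbrakk>x, y\<rbrakk>]"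
proof -
  have "{(i, j). 1 \<le> i \<and> i < j \<and> j \<le> 1 + (1::nat)} = {(1, 2)}"
    by auto
  moreover have "{2..1 + 1::nat} = {2}" by auto
  ultimately show ?thesis
    by (simp add: coboundary_map_def omit_def)
qed

lemma coboundary_map_2:
  "coboundary_map 2 f [x, y, z] = \<lbrakk>x, f [y, z]\<rbrakk> + \<lbrakk>f [x, z], y\<rbrakk> - \<lbrakk>f [x, y], z\<rbrakk>
    - f [\<lbrakk>x, y\<rbrakk>, z] + f [\<lbrakk>x, z\<rbrakk>, y] + f [x, \<lbrakk>y, z\<rbrakk>]"
proof -
  have "{(i, j). 1 \<le> i \<and> i < j \<and> j \<le> 2 + (1::nat)} = {(1, 2), (1, 3), (2, 3)}"
    by auto
  moreover have "{2..2 + 1::nat} = {2, 3}" by auto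
  ultimately show ?thesis
    by (simp add: coboundary_map_def omit_def numeral_eq_Suc)
qed

lemma cochains_1_iff:
  "f \<in> cochains 1 \<longleftrightarrow> Vector_Spaces.linear scale scale (\<lambda>x. f [x]) \<and> (\<forall>xs. length xs \<noteq> 1 \<longrightarrow> f xs = 0)"
  by (auto simp: cochains_def length_Suc_conv)

lemma cochains_2_iff:
  "f \<in> cochains 2 \<longleftrightarrow> (\<forall>y. Vector_Spaces.linear scale scale (\<lambda>x. f [x, y]))
    \<and> (\<forall>x. Vector_Spaces.linear scale scale (\<lambda>y. f [x, y])) \<and> (\<forall>xs. length xs \<noteq> 2 \<longrightarrow> f xs = 0)"
proof (intro iffI conjI allI impI)
  assume f: "f \<in> cochains 2"
  have lin: "Vector_Spaces.linear scale scale (\<lambda>v. f ([x, y][i := v]))" if i: "i < 2" for x y i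
  proof -
    have "length [x, y] = 2" by simp
    with f i show ?thesis unfolding cochains_def by blast
  qed
  show "Vector_Spaces.linear scale scale (\<lambda>x. f [x, y])" for y
    using lin[of 0 _ y] by simp
  show "Vector_Spaces.linear scale scale (\<lambda>y. f [x, y])" for x
    using lin[of 1 x] by simp
  show "f xs = 0" if "length xs \<noteq> 2" for xs
    using f that by (simp add: cochains_def)
next
  assume f: "(\<forall>y. Vector_Spaces.linear scale scale (\<lambda>x. f [x, y]))
    \<and> (\<forall>x. Vector_Spaces.linear scale scale (\<lambda>y. f [x, y])) \<and> (\<forall>xs. length xs \<noteq> 2 \<longrightarrow> f xs = 0)"
  then show "f \<in> cochains 2"
    by (auto simp: cochains_def length_Suc_conv numeral_2_eq_2 less_Suc_eq)
qed

text \<open>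
  This is \<open>\<delta>\<^sup>2 \<circ> \<delta>\<^sup>1 = 0\<close>: after expanding by bilinearity and rewriting nested brackets
  with the Leibniz identity, all terms cancel.
\<close>

lemma coboundaries_2_subset_cocycles: "coboundaries 2 \<subseteq> cocycles 2"
proof
  fix h assume "h \<in> coboundaries 2"
  then obtain f where "f \<in> cochains 1" and h: "h = coboundary_map 1 f"
    by (auto simp: coboundaries_def numeral_2_eq_2)
  then have f: "Vector_Spaces.linear scale scale (\<lambda>x. f [x])"
    by (simp add: cochains_1_iff del: One_nat_def)
  interpret f: Vector_Spaces.linear scale scale "\<lambda>x. f [x]" by (rule f)
  have h_pair: "h [x, y] = \<lbrakk>x, f [y]\<rbrakk> + \<lbrakk>f [x], y\<rbrakk> - f [\<lbrakk>x, y\<rbrakk>]" for x y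
    unfolding h by (rule coboundary_map_1)
  note simps = bracket_simps f.add f.scale f.neg f.diff h_pair scale_right_distrib scale_right_diff_distrib
  have "h \<in> cochains 2"
    unfolding cochains_2_iff Vector_Spaces.linear_iff
    by (auto simp: simps vector_space_axioms algebra_simps) (simp add: h coboundary_map_def)
  moreover have "coboundary_map 2 h xs = 0" for xs
  proof (cases "length xs = 3")
    case True
    then obtain x y z where "xs = [x, y, z]"
      by (auto simp: length_Suc_conv numeral_3_eq_3)
    then show ?thesis
      by (simp add: coboundary_map_2 simps leibniz)
  qed (simp add: coboundary_map_def)
  ultimately show "h \<in> cocycles 2"
    by (auto simp: cocycles_def)
qed

lemma submodule_coboundaries_2: "submodule class_ring (coboundaries 2) (cocycle_module 2)"
proof (rule submodule.intro)
  show "Module.module class_ring (cocycle_module 2)"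
    by (rule vectorspace.axioms(1)[OF vectorspace_cocycle_module])
  have B: "coboundaries 2 = coboundary_map 1 ` cochains 1"
    by (simp add: coboundaries_def numeral_2_eq_2)
  show "coboundaries 2 \<subseteq> carrier (cocycle_module 2)"
    using coboundaries_2_subset_cocycles by (simp add: cocycle_module_def)
  show "f \<oplus>\<^bsub>cocycle_module 2\<^esub> g \<in> coboundaries 2" if "f \<in> coboundaries 2" "g \<in> coboundaries 2" for f g
    using that by (auto simp: B cocycle_module_def coboundary_map_add[symmetric] add_cochain)
  show scale: "c \<odot>\<^bsub>cocycle_module 2\<^esub> f \<in> coboundaries 2" if "f \<in> coboundaries 2" for c f
    using that by (auto simp: B cocycle_module_def coboundary_map_scale[symmetric] scale_cochain)
  have "coboundary_map 1 (\<lambda>_. 0) \<in> coboundaries 2"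
    unfolding B by (intro imageI zero_cochain)
  from scale[OF this, of 0] show "\<zero>\<^bsub>cocycle_module 2\<^esub> \<in> coboundaries 2"
    by (simp add: cocycle_module_def)
qed

end

section \<open>Cochains of the Heisenberg algebra\<close>

lemma ee_nth: "ee i $ j = (if j = i then 1 else 0)"
  by (simp add: axis_def)

lemma phi_bar_eq:
  "phi_bar =
    [\<lambda>x y. (x $ 2 * y $ 3 - x $ 3 * y $ 2) *s ee 3,
     \<lambda>x y. (x $ 1 * y $ 2 - x $ 2 * y $ 1) *s ee 2 - (x $ 1 * y $ 3 - x $ 3 * y $ 1) *s ee 3,
     \<lambda>x y. (x $ 1 * y $ 2 - x $ 2 * y $ 1) *s ee 3,
     \<lambda>x y. (x $ 1 * y $ 3 - x $ 3 * y $ 1) *s ee 1,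
     \<lambda>x y. (x $ 1 * y $ 3 - x $ 3 * y $ 1) *s ee 2,
     \<lambda>x y. (x $ 2 * y $ 2) *s ee 1,
     \<lambda>x y. (x $ 3 * y $ 2) *s ee 1,
     \<lambda>x y. (x $ 3 * y $ 3) *s ee 1]"
  by (simp add: phi_bar_def fun_eq_iff algebra_simps bilinear_of_def sum_3 Finite_Cartesian_Product.vec_eq_iff forall_3 ee_nth)

lemma cochain_of_phi_bar: "\<phi> \<in> set phi_bar \<Longrightarrow> cochain_of \<phi> \<in> heisenberg.cochains 2"
  unfolding heisenberg.cochains_2_iff
  by (auto simp: phi_bar_def cochain_of_def linear_bilinear_of_left linear_bilinear_of_right
      split: list.split)

lemma cocycle_of_phi_bar:
  assumes "\<phi> \<in> set phi_bar"
  shows "cochain_of \<phi> \<in> heisenberg.cocycles 2"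
proof -
  have "heisenberg.coboundary_map 2 (cochain_of \<phi>) xs = 0" for xs
  proof (cases "length xs = 3")
    case True
    then obtain x y z where "xs = [x, y, z]"
      by (auto simp: length_Suc_conv numeral_3_eq_3)
    with assms show ?thesis
      by (auto simp: heisenberg.coboundary_map_2 cochain_of_def phi_bar_eq heisenberg_bracket_eq
          Finite_Cartesian_Product.vec_eq_iff forall_3 ee_nth algebra_simps)
  qed (simp add: heisenberg.coboundary_map_def)
  then show ?thesis
    using cochain_of_phi_bar[OF assms] by (auto simp: heisenberg.cocycles_def)
qed

lemma linear_expansion:
  assumes "Vector_Spaces.linear (*s) (*s) (f :: complex ^ 3 \<Rightarrow> complex ^ 3)"
  shows "f x = x $ 1 *s f (ee 1) + x $ 2 *s f (ee 2) + x $ 3 *s f (ee 3)"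
proof -
  interpret f: Vector_Spaces.linear "(*s)" "(*s)" f by (rule assms)
  have "f x = f (x $ 1 *s ee 1 + x $ 2 *s ee 2 + x $ 3 *s ee 3)"
    by (rule arg_cong[where f = f]) (simp add: Finite_Cartesian_Product.vec_eq_iff forall_3 ee_nth)
  then show ?thesis
    by (simp only: f.add f.scale)
qed

lemma cochains_2_eqI:
  assumes "f \<in> heisenberg.cochains 2" and "g \<in> heisenberg.cochains 2"
    and eq: "\<And>i j. f [ee i, ee j] = g [ee i, ee j]"
  shows "f = g"
proof
  fix xs
  show "f xs = g xs"
  proof (cases "length xs = 2")
    case True
    then obtain x y where xs: "xs = [x, y]"
      by (auto simp: length_Suc_conv numeral_2_eq_2)
    note lin = assms(1,2)[unfolded heisenberg.cochains_2_iff]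
    have "f [ee i, y] = g [ee i, y]" for i
      using lin linear_expansion[of "\<lambda>y. f [ee i, y]" y] linear_expansion[of "\<lambda>y. g [ee i, y]" y]
      by (simp add: eq)
    then show ?thesis
      using lin linear_expansion[of "\<lambda>x. f [x, y]" x] linear_expansion[of "\<lambda>x. g [x, y]" x]
      by (simp add: xs)
  next
    case False
    with assms(1,2) show ?thesis
      by (simp add: heisenberg.cochains_2_iff)
  qed
qed

section \<open>Coordinates of a cohomology class\<close>

text \<open>
  The entries are in the order of \<open>phi_bar\<close>. The two summands of entries 0, 3 and 6
  are chosen so as to cancel on the coboundary of \<open>e\<^sub>1 \<mapsto> e\<^sub>3\<close>, of \<open>e\<^sub>1 \<mapsto> e\<^sub>2\<close>
  and of \<open>e\<^sub>2 \<mapsto> e\<^sub>2\<close>, respectively.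
\<close>

definition class_coord :: "nat \<Rightarrow> ((complex ^ 3) list \<Rightarrow> complex ^ 3) \<Rightarrow> complex" where
  "class_coord i f =
    [f [ee 2, ee 3] $ 3 - f [ee 1, ee 2] $ 1,
     f [ee 1, ee 2] $ 2,
     f [ee 1, ee 2] $ 3,
     f [ee 1, ee 3] $ 1 + f [ee 2, ee 3] $ 2,
     f [ee 1, ee 3] $ 2,
     f [ee 2, ee 2] $ 1,
     f [ee 2, ee 3] $ 1 + f [ee 3, ee 2] $ 1,
     f [ee 3, ee 3] $ 1] ! i"

lemma all_less_8: "(\<forall>i<8. P i) \<longleftrightarrow> P 0 \<and> P 1 \<and> P 2 \<and> P 3 \<and> P 4 \<and> P 5 \<and> P 6 \<and> P (7::nat)"
  by (simp add: numeral_eq_Suc All_less_Suc conj_ac)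

lemma class_coord_add:
  assumes "i < 8"
  shows "class_coord i (\<lambda>xs. f xs + g xs) = class_coord i f + class_coord i g"
proof -
  have "\<forall>i<8. class_coord i (\<lambda>xs. f xs + g xs) = class_coord i f + class_coord i g"
    unfolding all_less_8 by (simp add: class_coord_def)
  with assms show ?thesis by blast
qed

lemma class_coord_scale:
  assumes "i < 8"
  shows "class_coord i (\<lambda>xs. c *s f xs) = c * class_coord i f"
proof -
  have "\<forall>i<8. class_coord i (\<lambda>xs. c *s f xs) = c * class_coord i f"
    unfolding all_less_8 by (simp add: class_coord_def algebra_simps)
  with assms show ?thesis by blast
qed

lemma class_coord_phi_bar:
  assumes "i < 8" "j < 8"
  shows "class_coord i (cochain_of (phi_bar ! j)) = (if i = j then 1 else 0)"
proof -
  have "\<forall>i<8. \<forall>j<8. class_coord i (cochain_of (phi_bar ! j)) = (if i = j then 1 else 0)"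
    unfolding all_less_8 by (simp add: class_coord_def phi_bar_eq cochain_of_def ee_nth)
  with assms show ?thesis by blast
qed

lemma class_coord_coboundary:
  assumes f: "f \<in> heisenberg.cochains 1" and "i < 8"
  shows "class_coord i (heisenberg.coboundary_map 1 f) = 0"
proof -
  have lin: "Vector_Spaces.linear (*s) (*s) (\<lambda>x. f [x])"
    using f unfolding heisenberg.cochains_1_iff by blast
  interpret f: Vector_Spaces.linear "(*s)" "(*s)" "\<lambda>x. f [x]" by (rule lin)
  have "\<forall>i<8. class_coord i (heisenberg.coboundary_map 1 f) = 0"
    unfolding all_less_8 class_coord_def heisenberg.coboundary_map_1 heisenberg_bracket_eq
    by (simp add: ee_nth f.zero f.neg f.scale)
  with assms(2) show ?thesis by blast
qed

text \<open>
  The linear system of the cocycle condition, solved. Each of the facts named by three digits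
  comes from the cocycle identity on that triple of basis vectors.
\<close>

lemma cocycle_values:
  assumes z: "z \<in> heisenberg.cocycles 2"
  shows "z [ee 1, ee 1] = 0"
    and "z [ee 2, ee 1] = - z [ee 1, ee 2]" and "z [ee 3, ee 1] = - z [ee 1, ee 3]"
    and "z [ee 1, ee 3] $ 3 = - z [ee 1, ee 2] $ 2"
    and "z [ee 3, ee 2] $ 2 = - z [ee 2, ee 3] $ 2" and "z [ee 3, ee 2] $ 3 = - z [ee 2, ee 3] $ 3"
    and "z [ee 2, ee 2] $ 2 = 0" and "z [ee 2, ee 2] $ 3 = 0"
    and "z [ee 3, ee 3] $ 2 = 0" and "z [ee 3, ee 3] $ 3 = 0"
proof -
  have z2: "z \<in> heisenberg.cochains 2"
    using z by (simp add: heisenberg.cocycles_def)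
  interpret l: Vector_Spaces.linear "(*s)" "(*s)" "\<lambda>x. z [x, y]" for y
    using z2 unfolding heisenberg.cochains_2_iff by blast
  interpret r: Vector_Spaces.linear "(*s)" "(*s)" "\<lambda>y. z [x, y]" for x
    using z2 unfolding heisenberg.cochains_2_iff by blast
  have "heisenberg.coboundary_map 2 z [x, y, w] = 0" for x y w
    using z by (simp add: heisenberg.cocycles_def)
  note dz = this[unfolded heisenberg.coboundary_map_2 heisenberg_bracket_eq
      Finite_Cartesian_Product.vec_eq_iff forall_3]
  note simps = ee_nth l.zero r.zero l.neg r.neg
  have 222: "z [ee 2, ee 2] $ 3 = 0"
    using dz[of "ee 2" "ee 2" "ee 2"] by (simp add: simps)
  have 322: "z [ee 2, ee 2] $ 2 = 0"
    using dz[of "ee 3" "ee 2" "ee 2"] by (simp add: simps)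
  have 233: "z [ee 3, ee 3] $ 3 = 0"
    using dz[of "ee 2" "ee 3" "ee 3"] by (simp add: simps)
  have 333: "z [ee 3, ee 3] $ 2 = 0"
    using dz[of "ee 3" "ee 3" "ee 3"] by (simp add: simps)
  have 223: "z [ee 2, ee 1] $ k = - z [ee 1, ee 2] $ k" for k
    using dz[of "ee 2" "ee 2" "ee 3"] 322 exhaust_3[of k]
    by (auto simp: simps add_eq_0_iff)
  have 332: "z [ee 3, ee 1] $ k = - z [ee 1, ee 3] $ k" for k
    using dz[of "ee 3" "ee 3" "ee 2"] 233 exhaust_3[of k]
    by (auto simp: simps add_eq_0_iff)
  have 123: "z [ee 1, ee 1] $ 1 = z [ee 1, ee 2] $ 2 + z [ee 1, ee 3] $ 3"
    "z [ee 1, ee 1] $ 2 = 0" "z [ee 1, ee 1] $ 3 = 0"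
    using dz[of "ee 1" "ee 2" "ee 3"] by (simp_all add: simps algebra_simps)
  have 213: "z [ee 1, ee 1] $ 1 + z [ee 1, ee 3] $ 3 = z [ee 2, ee 1] $ 2"
    using dz[of "ee 2" "ee 1" "ee 3"] by (simp add: simps algebra_simps)
  \<comment> \<open>Together with the first equation of \<open>123\<close>, this value equals its own negative.\<close>
  have "z [ee 1, ee 1] $ 1 = - z [ee 1, ee 2] $ 2 - z [ee 1, ee 3] $ 3"
    using 213 223[of 2] by (simp only: eq_diff_eq)
  from arg_cong2[where f = "(+)", OF 123(1) this] have 11: "z [ee 1, ee 1] $ 1 = 0"
    by simp
  show "z [ee 2, ee 1] = - z [ee 1, ee 2]" "z [ee 3, ee 1] = - z [ee 1, ee 3]" "z [ee 1, ee 1] = 0"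
    using 223 332 11 123 by (simp_all add: Finite_Cartesian_Product.vec_eq_iff forall_3)
  show "z [ee 1, ee 3] $ 3 = - z [ee 1, ee 2] $ 2"
    using 123(1) 11 by (simp add: eq_neg_iff_add_eq_0 add.commute)
  show "z [ee 3, ee 2] $ 3 = - z [ee 2, ee 3] $ 3"
    using dz[of "ee 2" "ee 3" "ee 2"] 322 223[of 1] by (simp add: simps eq_neg_iff_add_eq_0)
  show "z [ee 3, ee 2] $ 2 = - z [ee 2, ee 3] $ 2"
    using dz[of "ee 3" "ee 2" "ee 3"] 233 332[of 1] by (simp add: simps) algebra
  show "z [ee 2, ee 2] $ 2 = 0" "z [ee 2, ee 2] $ 3 = 0" "z [ee 3, ee 3] $ 2 = 0" "z [ee 3, ee 3] $ 3 = 0"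
    by (fact 222 322 233 333)+
qed

text \<open>
  When the eight coordinates vanish, a cocycle is determined by the three parameters
  \<open>f\<^sub>1\<^sub>2\<^sup>1\<close>, \<open>f\<^sub>2\<^sub>3\<^sup>2\<close> and \<open>f\<^sub>2\<^sub>3\<^sup>1\<close>, where the upper index
  denotes the component. The linear map
  \<open>e\<^sub>1 \<mapsto> - f\<^sub>2\<^sub>3\<^sup>2 e\<^sub>2 - f\<^sub>1\<^sub>2\<^sup>1 e\<^sub>3\<close>,
  \<open>e\<^sub>2 \<mapsto> f\<^sub>2\<^sub>3\<^sup>1 e\<^sub>2\<close>, \<open>e\<^sub>3 \<mapsto> 0\<close> has a coboundary with the same three parameters.
\<close>

lemma cocycle_is_coboundaryI:
  assumes z: "z \<in> heisenberg.cocycles 2" and 0: "\<forall>i<8. class_coord i z = 0"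
  shows "z \<in> heisenberg.coboundaries 2"
proof -
  define g :: "(complex ^ 3) list \<Rightarrow> complex ^ 3" where
    "g xs = (case xs of
       [x] \<Rightarrow> x $ 1 *s (- (z [ee 2, ee 3] $ 2) *s ee 2 - z [ee 1, ee 2] $ 1 *s ee 3)
             + x $ 2 *s (z [ee 2, ee 3] $ 1 *s ee 2)
     | _ \<Rightarrow> 0)" for xs
  have "g \<in> heisenberg.cochains 1"
    unfolding heisenberg.cochains_1_iff Vector_Spaces.linear_iff
    by (auto simp: g_def vec.vector_space_axioms Finite_Cartesian_Product.vec_eq_iff forall_3
        algebra_simps split: list.split)
  then have B: "heisenberg.coboundary_map 1 g \<in> heisenberg.coboundaries 2"
    by (simp add: heisenberg.coboundaries_def numeral_2_eq_2)
  have "z = heisenberg.coboundary_map 1 g"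
  proof (rule cochains_2_eqI)
    show "z \<in> heisenberg.cochains 2" "heisenberg.coboundary_map 1 g \<in> heisenberg.cochains 2"
      using z B heisenberg.coboundaries_2_subset_cocycles by (auto simp: heisenberg.cocycles_def)
    have C: "z [ee 2, ee 3] $ 3 = z [ee 1, ee 2] $ 1" "z [ee 1, ee 2] $ 2 = 0" "z [ee 1, ee 2] $ 3 = 0"
      "z [ee 1, ee 3] $ 1 = - z [ee 2, ee 3] $ 2" "z [ee 1, ee 3] $ 2 = 0" "z [ee 2, ee 2] $ 1 = 0"
      "z [ee 3, ee 2] $ 1 = - z [ee 2, ee 3] $ 1" "z [ee 3, ee 3] $ 1 = 0"
      using 0[unfolded all_less_8] by (simp_all add: class_coord_def eq_neg_iff_add_eq_0 add.commute)
    have "\<forall>i j. z [ee i, ee j] = heisenberg.coboundary_map 1 g [ee i, ee j]"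
      unfolding forall_3 heisenberg.coboundary_map_1
      by (simp add: Finite_Cartesian_Product.vec_eq_iff forall_3 g_def heisenberg_bracket_eq ee_nth
          cocycle_values[OF z] C)
    then show "z [ee i, ee j] = heisenberg.coboundary_map 1 g [ee i, ee j]" for i j
      by blast
  qed
  with B show ?thesis by simp
qed

section \<open>The second cohomology\<close>

theorem mainTheorem1:
  shows "vectorspace class_ring (heisenberg.HL 2)
    \<and> vectorspace.dim class_ring (heisenberg.HL 2) = 8
    \<and> (\<forall>\<phi> \<in> set phi_bar. cochain_of \<phi> \<in> heisenberg.cocycles 2)
    \<and> distinct (map (heisenberg.cohomology_class 2 \<circ> cochain_of) phi_bar)
    \<and> vectorspace.basis class_ring (heisenberg.HL 2)
        (set (map (heisenberg.cohomology_class 2 \<circ> cochain_of) phi_bar))"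
proof -
  let ?V = "heisenberg.cocycle_module 2" and ?B = "heisenberg.coboundaries 2"
  let ?w = "\<lambda>i. cochain_of (phi_bar ! i)"
    and ?c = "\<lambda>i. heisenberg.cohomology_class 2 (cochain_of (phi_bar ! i))"
  have len: "length phi_bar = 8" by (simp add: phi_bar_def)
  have w: "?w \<in> {..<8} \<rightarrow> carrier ?V"
    using cocycle_of_phi_bar len by (auto simp: heisenberg.cocycle_module_def)
  have kernel: "f \<in> ?B \<longleftrightarrow> (\<forall>i\<in>{..<8}. class_coord i f = \<zero>\<^bsub>class_ring\<^esub>)" if "f \<in> carrier ?V" for f
  proof
    assume "f \<in> ?B"
    then obtain h where "h \<in> heisenberg.cochains 1" "f = heisenberg.coboundary_map 1 h"
      by (auto simp: heisenberg.coboundaries_def numeral_2_eq_2)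
    then show "\<forall>i\<in>{..<8}. class_coord i f = \<zero>\<^bsub>class_ring\<^esub>"
      using class_coord_coboundary by (simp del: One_nat_def)
  next
    assume "\<forall>i\<in>{..<8}. class_coord i f = \<zero>\<^bsub>class_ring\<^esub>"
    with that show "f \<in> ?B"
      by (intro cocycle_is_coboundaryI) (auto simp: heisenberg.cocycle_module_def)
  qed
  have HL: "vectorspace class_ring (heisenberg.HL 2)" "inj_on ?c {..<8}"
    "vectorspace.basis class_ring (heisenberg.HL 2) (?c ` {..<8})"
    unfolding heisenberg.HL_def heisenberg.cohomology_class_def
    by (rule quotient_basis_if_dual_family[OF heisenberg.vectorspace_cocycle_module
          heisenberg.submodule_coboundaries_2 finite_lessThan w, where d = class_coord];
        simp add: kernel class_coord_add class_coord_scale class_coord_phi_bar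
          heisenberg.cocycle_module_def)+
  have classes: "map (heisenberg.cohomology_class 2 \<circ> cochain_of) phi_bar = map ?c [0..<8]"
    by (rule nth_equalityI) (simp_all add: len)
  have set: "set (map ?c [0..<8]) = ?c ` {..<8}"
    by (simp add: atLeast0LessThan)
  have dim: "vectorspace.dim class_ring (heisenberg.HL 2) = 8"
    using vectorspace.dim_basis[OF HL(1) _ HL(3)] card_image[OF HL(2)] by simp
  have dist: "distinct (map ?c [0..<8])"
    using HL(2) by (simp add: distinct_map atLeast0LessThan)
  show ?thesis
    using HL dim dist cocycle_of_phi_bar unfolding classes set by blast
qed

end
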